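(* Let $\mathbb{K}$ be an algebraically closed field, $V$ a $\mathbb{K}$-vector space of finite positive dimension, and $\Phi=(A;\{E_i\}_{i=0}^d;A^*;\{E_i^*\}_{i=0}^d)$ a TD system on $V$ of diameter $d\geq 1$ that has $q$-Racah type, with fixed associated scalars $q,a,b$. Let $\mathcal{M}\in\mathrm{End}(V)$ be the associated map defined in the context. Then $\mathcal{M}$ is diagonalizable with eigenvalues $q^{d},q^{d-2},q^{d-4},\ldots,q^{-d}$.
   Context: TD pair: an ordered pair of linear maps $A,A^*:V\to V$ such that (i) each is diagonalizable; (ii) there is an ordering $\{V_i\}_{i=0}^d$ of the eigenspaces of $A$ with $A^*V_i\subseteq V_{i-1}+V_i+V_{i+1}$ for $0\le i\le d$ ($V_{-1}=V_{d+1}=0$); (iii) there is an ordering $\{V_i^*\}_{i=0}^\delta$ of the eigenspaces of $A^*$ with $AV_i^*\subseteq V_{i-1}^*+V_i^*+V_{i+1}^*$ for $0\le i\le\delta$ ($V^*_{-1}=V^*_{\delta+1}=0$); (iv) no subspace $W$ with $0\ne W\ne V$ satisfies $AW\subseteq W$ and $A^*W\subseteq W$. It is known that $d=\delta$; $d$ is called the diameter. Orderings as in (ii), (iii) are called standard. The primitive idempotent of $A$ for an eigenspace $V_i$ is the projection of $V$ onto $V_i$ that vanishes on the other eigenspaces (similarly for $A^*$). TD system: $(A;\{E_i\}_{i=0}^d;A^*;\{E_i^*\}_{i=0}^d)$ where $A,A^*$ is a TD pair and $\{E_i\}$, $\{E_i^*\}$ are the primitive idempotents of $A$, $A^*$,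 in orders for which the corresponding eigenspace orderings $\{E_iV\}$, $\{E_i^*V\}$ are standard. Let $\theta_i$ (resp. $\theta_i^*$) be the eigenvalue of $A$ on $E_iV$ (resp. of $A^*$ on $E_i^*V$). $\Phi$ has $q$-Racah type if there are nonzero $q,a,b\in\mathbb{K}$ with $q^4\ne1$ and $\theta_i=aq^{d-2i}+a^{-1}q^{2i-d}$, $\theta_i^*=bq^{d-2i}+b^{-1}q^{2i-d}$ for $0\le i\le d$. (Distinctness of eigenvalues forces $q^{2i}\neq1$ for $1\le i\le d$, and $a^2\ne q^{2d-2},q^{2d-4},\dots,q^{2-2d}$; in particular $a^2\neq 1$.) Split decompositions: $U_i=(E_0^*V+\cdots+E_i^*V)\cap(E_iV+\cdots+E_dV)$ and $U_i^\Downarrow=(E_0^*V+\cdots+E_i^*V)\cap(E_0V+\cdots+E_{d-i}V)$ for $0\le i\le d$. It is known that $V=\bigoplus_i U_i=\bigoplus_i U_i^\Downarrow$ with all summands nonzero. $K,B\in\mathrm{End}(V)$ are the linear maps acting on $U_i$, respectively $U_i^\Downarrow$, as the scalar $q^{d-2i}$ ($0\le i\le d$). $\mathcal{M}\in\mathrm{End}(V)$: $\mathcal{M}=\dfrac{aK-a^{-1}B}{a-a^{-1}}$. *)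

theory Defs
  imports "HOL-Computational_Algebra.Polynomial"
begin

text \<open>
  The vector space \<open>V\<close> is the whole type \<open>'b\<close>, with scalar multiplication \<open>scale\<close>.
  Families indexed by \<open>0, \<dots>, d\<close> are functions on \<^typ>\<open>nat\<close> whose values above \<open>d\<close> are
  never inspected. A sum of subspaces is the span of their union.
\<close>

text \<open>
  A locale equivalent to \<^locale>\<open>vector_space\<close>: definitions made inside \<^locale>\<open>vector_space\<close> itself
  would be captured by its global interpretation for \<open>real_vector\<close>.
\<close>

locale tridiagonal = vector_space scale
  for scale :: "'a::field \<Rightarrow> 'b::ab_group_add \<Rightarrow> 'b" (infixr \<open>*s\<close> 75)
begin

definition eigenspace :: "('b \<Rightarrow> 'b) \<Rightarrow> 'a \<Rightarrow> 'b set" where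
  "eigenspace f c = {v. f v = c *s v}"

definition eigenvalue :: "('b \<Rightarrow> 'b) \<Rightarrow> 'a \<Rightarrow> bool" where
  "eigenvalue f c \<longleftrightarrow> (\<exists>v. v \<noteq> 0 \<and> f v = c *s v)"

definition eigenspaces :: "('b \<Rightarrow> 'b) \<Rightarrow> 'b set set" where
  "eigenspaces f = {eigenspace f c | c. eigenvalue f c}"

definition diagonalizable :: "('b \<Rightarrow> 'b) \<Rightarrow> bool" where
  "diagonalizable f \<longleftrightarrow> Vector_Spaces.linear scale scale f \<and> span (\<Union>(eigenspaces f)) = UNIV"

text \<open>
  \<open>standard_ordering f g d W\<close>: the sequence \<open>W 0, \<dots>, W d\<close> lists the eigenspaces of \<open>f\<close> without
  repetition, and \<open>g\<close> acts on it tridiagonally. The condition \<open>j \<le> d\<close> (and \<open>j\<close> being a natural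
  number) implements the convention that the \<open>(-1)\<close>-st and \<open>(d + 1)\<close>-st subspaces are zero.
\<close>

definition standard_ordering ::
    "('b \<Rightarrow> 'b) \<Rightarrow> ('b \<Rightarrow> 'b) \<Rightarrow> nat \<Rightarrow> (nat \<Rightarrow> 'b set) \<Rightarrow> bool" where
  "standard_ordering f g d W \<longleftrightarrow>
     bij_betw W {..d} (eigenspaces f) \<and>
     (\<forall>i\<le>d. g ` W i \<subseteq> span (\<Union>j\<in>{j. j \<le> d \<and> i \<le> j + 1 \<and> j \<le> i + 1}. W j))"

definition td_pair :: "('b \<Rightarrow> 'b) \<Rightarrow> ('b \<Rightarrow> 'b) \<Rightarrow> bool" where
  "td_pair A As \<longleftrightarrow>
     diagonalizable A \<and> diagonalizable As \<and>
     (\<exists>d W. standard_ordering A As d W) \<and>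
     (\<exists>\<delta> Ws. standard_ordering As A \<delta> Ws) \<and>
     \<not> (\<exists>W. subspace W \<and> W \<noteq> {0} \<and> W \<noteq> UNIV \<and> A ` W \<subseteq> W \<and> As ` W \<subseteq> W)"

definition primitive_idempotent :: "('b \<Rightarrow> 'b) \<Rightarrow> 'b set \<Rightarrow> ('b \<Rightarrow> 'b) \<Rightarrow> bool" where
  "primitive_idempotent f W P \<longleftrightarrow>
     W \<in> eigenspaces f \<and> Vector_Spaces.linear scale scale P \<and>
     range P = W \<and> (\<forall>v\<in>W. P v = v) \<and>
     (\<forall>W'\<in>eigenspaces f - {W}. \<forall>v\<in>W'. P v = 0)"

definition td_system ::
    "nat \<Rightarrow> ('b \<Rightarrow> 'b) \<Rightarrow> (nat \<Rightarrow> 'b \<Rightarrow> 'b) \<Rightarrow> ('b \<Rightarrow> 'b) \<Rightarrow> (nat \<Rightarrow> 'b \<Rightarrow> 'b) \<Rightarrow> bool" where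
  "td_system d A E As Es \<longleftrightarrow>
     td_pair A As \<and>
     (\<forall>i\<le>d. primitive_idempotent A (range (E i)) (E i)) \<and>
     (\<forall>i\<le>d. primitive_idempotent As (range (Es i)) (Es i)) \<and>
     standard_ordering A As d (\<lambda>i. range (E i)) \<and>
     standard_ordering As A d (\<lambda>i. range (Es i))"

definition eigenvalue_sequence ::
    "nat \<Rightarrow> ('b \<Rightarrow> 'b) \<Rightarrow> (nat \<Rightarrow> 'b \<Rightarrow> 'b) \<Rightarrow> (nat \<Rightarrow> 'a) \<Rightarrow> bool" where
  "eigenvalue_sequence d f E \<theta> \<longleftrightarrow>
     (\<forall>i\<le>d. eigenvalue f (\<theta> i) \<and> range (E i) = eigenspace f (\<theta> i))"

definition q_racah_type ::
    "nat \<Rightarrow> ('b \<Rightarrow> 'b) \<Rightarrow> (nat \<Rightarrow> 'b \<Rightarrow> 'b) \<Rightarrow> ('b \<Rightarrow> 'b) \<Rightarrow> (nat \<Rightarrow> 'b \<Rightarrow> 'b) \<Rightarrow>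
      'a \<Rightarrow> 'a \<Rightarrow> 'a \<Rightarrow> bool" where
  "q_racah_type d A E As Es q a b \<longleftrightarrow>
     q \<noteq> 0 \<and> a \<noteq> 0 \<and> b \<noteq> 0 \<and> q ^ 4 \<noteq> 1 \<and>
     eigenvalue_sequence d A E
       (\<lambda>i. a * q powi (int d - 2 * int i) + inverse a * q powi (2 * int i - int d)) \<and>
     eigenvalue_sequence d As Es
       (\<lambda>i. b * q powi (int d - 2 * int i) + inverse b * q powi (2 * int i - int d))"

definition split_U ::
    "nat \<Rightarrow> (nat \<Rightarrow> 'b \<Rightarrow> 'b) \<Rightarrow> (nat \<Rightarrow> 'b \<Rightarrow> 'b) \<Rightarrow> nat \<Rightarrow> 'b set" where
  "split_U d E Es i =
     span (\<Union>j\<in>{0..i}. range (Es j)) \<inter> span (\<Union>j\<in>{i..d}. range (E j))"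

definition split_U_down ::
    "nat \<Rightarrow> (nat \<Rightarrow> 'b \<Rightarrow> 'b) \<Rightarrow> (nat \<Rightarrow> 'b \<Rightarrow> 'b) \<Rightarrow> nat \<Rightarrow> 'b set" where
  "split_U_down d E Es i =
     span (\<Union>j\<in>{0..i}. range (Es j)) \<inter> span (\<Union>j\<in>{0..d - i}. range (E j))"

text \<open>
  When \<open>V\<close> is the direct sum of \<open>W 0, \<dots>, W d\<close>, which holds for both split decompositions of a
  TD system, exactly one map \<open>f\<close> satisfies the following predicate.
\<close>

definition split_scalar_map :: "nat \<Rightarrow> 'a \<Rightarrow> (nat \<Rightarrow> 'b set) \<Rightarrow> ('b \<Rightarrow> 'b) \<Rightarrow> bool" where
  "split_scalar_map d q W f \<longleftrightarrow>
     Vector_Spaces.linear scale scale f \<and>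
     (\<forall>i\<le>d. \<forall>v\<in>W i. f v = q powi (int d - 2 * int i) *s v)"

definition M_map :: "'a \<Rightarrow> ('b \<Rightarrow> 'b) \<Rightarrow> ('b \<Rightarrow> 'b) \<Rightarrow> 'b \<Rightarrow> 'b" where
  "M_map a K B v = inverse (a - inverse a) *s (a *s K v - inverse a *s B v)"

end

end

theory Submission
  imports Defs
begin

text \<open>
  Write \<open>P\<^sub>n = E\<^sub>0\<^sup>*V + \<dots> + E\<^sub>n\<^sub>-\<^sub>1\<^sup>*V\<close> and \<open>\<mu>\<^sub>i = q\<^bsup>d-2i\<^esup>\<close>. Irreducibility gives
  \<open>U\<^sub>0 + \<dots> + U\<^sub>i = P\<^sub>i\<^sub>+\<^sub>1\<close> for both split decompositions, the second being the first one for the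
  reversed ordering of the eigenspaces of \<open>A\<close>. So \<open>K - \<mu>\<^sub>i\<close> and \<open>B - \<mu>\<^sub>i\<close> both map \<open>P\<^sub>i\<^sub>+\<^sub>1\<close> into
  \<open>P\<^sub>i\<close>, and therefore so does \<open>\<M> - \<mu>\<^sub>i\<close>, because the coefficients of \<open>K\<close> and \<open>B\<close> in \<open>\<M>\<close> add up
  to 1. Thus \<open>\<M>\<close> is triangular with respect to the strictly increasing flag \<open>P\<^sub>0 \<subset> \<dots> \<subset> P\<^sub>d\<^sub>+\<^sub>1\<close>,
  with pairwise distinct diagonal entries \<open>\<mu>\<^sub>i\<close>.
\<close>

section \<open>Linear maps that are triangular along a flag of subspaces\<close>

context tridiagonal
begin

lemma span_UN_mono: "I \<subseteq> J \<Longrightarrow> span (\<Union>i\<in>I. X i) \<subseteq> span (\<Union>i\<in>J. X i)"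
  by (intro span_mono) blast

text \<open>The vectors satisfying the conclusion form a subspace, so generators suffice. With
  \<open>c = 0\<close> this is used for plain inclusions \<open>f v \<in> S\<close>.\<close>

lemma linear_maps_span_into:
  assumes f: "Vector_Spaces.linear scale scale f" and S: "subspace S"
    and X: "\<And>v. v \<in> X \<Longrightarrow> f v - c *s v \<in> S" and v: "v \<in> span X"
  shows "f v - c *s v \<in> S"
proof -
  interpret f: Vector_Spaces.linear scale scale f by (fact f)
  show ?thesis using v
  proof (induction rule: span_induct_alt)
    case base
    show ?case using S by (simp add: f.zero subspace_0)
  next
    case (step k x y)
    have "f (k *s x + y) - c *s (k *s x + y) = k *s (f x - c *s x) + (f y - c *s y)"
      by (simp add: f.add f.scale algebra_simps)
    then show ?case using step X[of x] S by (simp add: subspace_add subspace_scale)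
  qed
qed

text \<open>On \<open>X i\<close> the map \<open>f - c\<close> is multiplication by the nonzero
  scalar \<open>\<mu> i - c\<close>, so it can be inverted one generator at a time.\<close>

lemma eigenvectors_solve_shifted:
  assumes f: "Vector_Spaces.linear scale scale f"
    and X: "\<And>i v. i \<in> I \<Longrightarrow> v \<in> X i \<Longrightarrow> f v = \<mu> i *s v"
    and c: "c \<notin> \<mu> ` I"
    and v: "v \<in> span (\<Union>i\<in>I. X i)"
  shows "\<exists>y \<in> span (\<Union>i\<in>I. X i). f y - c *s y = v"
proof -
  interpret f: Vector_Spaces.linear scale scale f by (fact f)
  show ?thesis using v
  proof (induction rule: span_induct_alt)
    case base
    show ?case by (intro bexI[of _ 0]) (auto simp: f.zero span_zero)
  next
    case (step k x y)
    from step.hyps obtain i where i: "i \<in> I" "x \<in> X i" by blast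
    from step obtain z where z: "z \<in> span (\<Union>i\<in>I. X i)" "f z - c *s z = y" by blast
    have ne: "\<mu> i - c \<noteq> 0" using c i by auto
    define t where "t = k / (\<mu> i - c)"
    have "t *s (f x - c *s x) = k *s x"
      using ne X[OF i] by (simp add: t_def flip: scale_left_diff_distrib)
    moreover have "f (t *s x + z) - c *s (t *s x + z) = t *s (f x - c *s x) + (f z - c *s z)"
      by (simp add: f.add f.scale algebra_simps)
    ultimately have "f (t *s x + z) - c *s (t *s x + z) = k *s x + y" using z by simp
    moreover have "t *s x + z \<in> span (\<Union>i\<in>I. X i)"
      using span_add[OF span_scale[OF span_base[OF step.hyps(1)]] z(1)] .
    ultimately show ?case by blast
  qed
qed

text \<open>Induction up the flag: if \<open>F i\<close> is spanned by eigenvectors for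
  \<open>\<mu> j\<close> with \<open>j < i\<close>, then \<open>f - \<mu> i\<close> is onto on
  \<open>F i\<close>. Hence any \<open>v\<close> in \<open>F (Suc i)\<close> can be corrected by
  some \<open>y\<close> in \<open>F i\<close> so that \<open>v - y\<close> is killed by
  \<open>f - \<mu> i\<close>. Strictness allows \<open>v\<close> outside \<open>F i\<close>, which
  makes \<open>v - y\<close> nonzero and \<open>\<mu> i\<close> an eigenvalue.\<close>

lemma triangular_flag_diagonalizable:
  assumes f: "Vector_Spaces.linear scale scale f"
    and F: "\<And>i. i \<le> n \<Longrightarrow> subspace (F i)" "F 0 = {0}" "F n = UNIV"
    and strict: "\<And>i. i < n \<Longrightarrow> F i \<subset> F (Suc i)"
    and tri: "\<And>i v. i < n \<Longrightarrow> v \<in> F (Suc i) \<Longrightarrow> f v - \<mu> i *s v \<in> F i"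
    and inj: "inj_on \<mu> {..<n}"
  shows "diagonalizable f" and "{c. eigenvalue f c} = \<mu> ` {..<n}"
proof -
  interpret f: Vector_Spaces.linear scale scale f by (fact f)
  define X where "X i = {v \<in> F (Suc i). f v = \<mu> i *s v}" for i
  have mono: "F i \<subseteq> F j" if "i \<le> j" "j \<le> n" for i j
    using that
  proof (induction j rule: dec_induct)
    case (step j)
    then show ?case using strict[of j] by auto
  qed simp
  have X_sub: "span (\<Union>j<i. X j) \<subseteq> F i" if "i \<le> n" for i
    using that mono[of "Suc _" i] F(1)[of i] by (intro span_minimal) (force simp: X_def)+
  have decompose: "\<exists>y \<in> span (\<Union>j<i. X j). v - y \<in> X i"
    if i: "i < n" and v: "v \<in> F (Suc i)" and le: "F i \<subseteq> span (\<Union>j<i. X j)" for i v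
  proof -
    have ev: "\<And>j w. j \<in> {..<i} \<Longrightarrow> w \<in> X j \<Longrightarrow> f w = \<mu> j *s w" by (simp add: X_def)
    have ni: "\<mu> i \<notin> \<mu> ` {..<i}" using inj_onD[OF inj, of i] i by force
    have "f v - \<mu> i *s v \<in> span (\<Union>j<i. X j)" using tri[OF i v] le by blast
    from eigenvectors_solve_shifted[OF f ev ni this]
    obtain y where y: "y \<in> span (\<Union>j<i. X j)" "f y - \<mu> i *s y = f v - \<mu> i *s v" by auto
    have "y \<in> F (Suc i)" using y X_sub[of i] i strict[OF i] by auto
    moreover have "f (v - y) = \<mu> i *s (v - y)" using y by (simp add: f.diff algebra_simps)
    ultimately have "v - y \<in> X i" using v F(1)[of "Suc i"] i by (simp add: X_def subspace_diff)
    with y show ?thesis by blast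
  qed
  have flag: "F i \<subseteq> span (\<Union>j<i. X j)" if "i \<le> n" for i
    using that
  proof (induction i)
    case 0
    show ?case by (simp add: F)
  next
    case (Suc i)
    show ?case
    proof
      fix v assume "v \<in> F (Suc i)"
      with decompose[of i v] Suc obtain y where y: "y \<in> span (\<Union>j<i. X j)" "v - y \<in> X i" by auto
      have "y \<in> span (\<Union>j<Suc i. X j)" using y span_UN_mono[of "{..<i}" "{..<Suc i}" X] by auto
      moreover have "v - y \<in> span (\<Union>j<Suc i. X j)" using y by (intro span_base) auto
      ultimately show "v \<in> span (\<Union>j<Suc i. X j)" using span_add[of y _ "v - y"] by simp
    qed
  qed
  \<comment> \<open>At this stage \<open>\<mu> j\<close> is not yet known to be an eigenvalue, so
    \<open>X j\<close> might be just the zero space; hence the inserted 0.\<close>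
  have "X j \<subseteq> insert 0 (\<Union>(eigenspaces f))" for j
    by (auto simp: X_def eigenspaces_def eigenspace_def eigenvalue_def)
  then have "span (\<Union>j<n. X j) \<subseteq> span (insert 0 (\<Union>(eigenspaces f)))"
    by (intro span_mono) blast
  then have "span (\<Union>j<n. X j) \<subseteq> span (\<Union>(eigenspaces f))" by simp
  with flag[of n] F f show "diagonalizable f" by (auto simp: diagonalizable_def)
  show "{c. eigenvalue f c} = \<mu> ` {..<n}"
  proof (intro equalityI subsetI)
    fix c assume "c \<in> \<mu> ` {..<n}"
    then obtain i where i: "i < n" "c = \<mu> i" by blast
    with strict obtain v where v: "v \<in> F (Suc i)" "v \<notin> F i" by blast
    with decompose[of i v] flag[of i] i
    obtain y where y: "y \<in> span (\<Union>j<i. X j)" "v - y \<in> X i" by auto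
    with X_sub[of i] i v have "v - y \<noteq> 0" by auto
    with y i show "c \<in> {c. eigenvalue f c}"
      unfolding eigenvalue_def mem_Collect_eq by (intro exI[of _ "v - y"]) (simp add: X_def)
  next
    fix c assume "c \<in> {c. eigenvalue f c}"
    then obtain v where v: "v \<noteq> 0" "f v = c *s v" by (auto simp: eigenvalue_def)
    show "c \<in> \<mu> ` {..<n}"
    proof (rule ccontr)
      assume c: "c \<notin> \<mu> ` {..<n}"
      \<comment> \<open>Descend the flag: if \<open>v\<close> is in \<open>F (Suc i)\<close>, then
        \<open>f v - \<mu> i *s v = (c - \<mu> i) *s v\<close> is in \<open>F i\<close>, and the
        scalar is invertible.\<close>
      have "v \<in> F 0" using le0[of n]
      proof (induction rule: inc_induct)
        case base
        show ?case by (simp add: F)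
      next
        case (step i)
        have "(c - \<mu> i) *s v \<in> F i"
          using tri[OF _ step.IH] step.hyps v by (simp add: scale_left_diff_distrib)
        then have "inverse (c - \<mu> i) *s (c - \<mu> i) *s v \<in> F i"
          using F(1)[of i] step.hyps by (blast intro: subspace_scale less_imp_le)
        moreover have "c - \<mu> i \<noteq> 0" using c step.hyps by auto
        ultimately show ?case by simp
      qed
      with v F show False by simp
    qed
  qed
qed

end

section \<open>The split decomposition attached to two flags\<close>

text \<open>
  \<open>W\<close> and \<open>Ws\<close> stand for the eigenspaces of \<open>A\<close> and \<open>As\<close>; the ordering of \<open>W\<close> is kept abstract
  since the locale is used for both \<open>E\<^sub>iV\<close> and \<open>E\<^sub>d\<^sub>-\<^sub>iV\<close>.
\<close>

locale split_flags = tridiagonal scale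
  for scale :: "'a::field \<Rightarrow> 'b::ab_group_add \<Rightarrow> 'b" (infixr \<open>*s\<close> 75) +
  fixes d :: nat and A As :: "'b \<Rightarrow> 'b" and \<theta> \<theta>s :: "nat \<Rightarrow> 'a" and W Ws :: "nat \<Rightarrow> 'b set"
  assumes linear_A: "Vector_Spaces.linear scale scale A"
    and linear_As: "Vector_Spaces.linear scale scale As"
    and A_W: "\<lbrakk>i \<le> d; v \<in> W i\<rbrakk> \<Longrightarrow> A v = \<theta> i *s v"
    and As_Ws: "\<lbrakk>i \<le> d; v \<in> Ws i\<rbrakk> \<Longrightarrow> As v = \<theta>s i *s v"
    and As_W: "i \<le> d \<Longrightarrow> As ` W i \<subseteq> span (\<Union>j\<in>{j. j \<le> d \<and> i \<le> j + 1 \<and> j \<le> i + 1}. W j)"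
    and A_Ws: "i \<le> d \<Longrightarrow> A ` Ws i \<subseteq> span (\<Union>j\<in>{j. j \<le> d \<and> i \<le> j + 1 \<and> j \<le> i + 1}. Ws j)"
    and irreducible: "\<lbrakk>subspace S; A ` S \<subseteq> S; As ` S \<subseteq> S\<rbrakk> \<Longrightarrow> S = {0} \<or> S = UNIV"
    and span_W: "span (\<Union>j\<le>d. W j) = UNIV"
    and Ws_0: "\<not> Ws 0 \<subseteq> {0}"
    and span_Ws: "span (\<Union>j<d. Ws j) \<noteq> UNIV"
begin

text \<open>The strict bound in \<open>P\<close> makes \<open>P 0\<close> zero, so the flag starts
  at the bottom; the split summand with index \<open>i\<close> is then
  \<open>P (Suc i) \<inter> Q i\<close>.\<close>

definition P :: "nat \<Rightarrow> 'b set" where "P n = span (\<Union>j<n. Ws j)"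
definition Q :: "nat \<Rightarrow> 'b set" where "Q n = span (\<Union>j\<in>{n..d}. W j)"

text \<open>Both \<open>A\<close> and \<open>As\<close> preserve \<open>Z r\<close>; \<open>Z 0\<close> is the sum of the split decomposition.\<close>

definition Z :: "nat \<Rightarrow> 'b set" where "Z r = span (\<Union>i\<le>d. P (Suc i) \<inter> Q (i + r))"

lemma subspace_P [simp]: "subspace (P n)" and subspace_Q [simp]: "subspace (Q n)"
  and subspace_Z [simp]: "subspace (Z r)"
  by (simp_all add: P_def Q_def Z_def)

lemma P_mono: "m \<le> n \<Longrightarrow> P m \<subseteq> P n"
  unfolding P_def by (intro span_UN_mono) auto

lemma Q_antimono: "m \<le> n \<Longrightarrow> Q n \<subseteq> Q m"
  unfolding Q_def by (intro span_UN_mono) auto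

lemma P_0: "P 0 = {0}"
  by (simp add: P_def)

lemma Q_0: "Q 0 = UNIV"
  using span_W by (simp add: Q_def atMost_atLeast0)

lemma Q_above: "d < n \<Longrightarrow> Q n = {0}"
  by (simp add: Q_def)

section \<open>Action of \<open>A\<close> and \<open>As\<close> on the two flags\<close>

text \<open>\<open>A - \<theta> n\<close> kills \<open>W n\<close>, and the later \<open>W j\<close>
  already lie in \<open>Q (Suc n)\<close>, where \<open>A\<close> only scales them.\<close>

lemma A_Q:
  assumes "v \<in> Q n"
  shows "A v - \<theta> n *s v \<in> Q (Suc n)"
proof (rule linear_maps_span_into[OF linear_A subspace_Q _ assms[unfolded Q_def]])
  fix w assume "w \<in> (\<Union>j\<in>{n..d}. W j)"
  then obtain j where j: "n \<le> j" "j \<le> d" "w \<in> W j" by auto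
  show "A w - \<theta> n *s w \<in> Q (Suc n)"
  proof (cases "j = n")
    case True
    then show ?thesis using j A_W subspace_Q by (simp add: subspace_0)
  next
    case False
    then have "w \<in> Q (Suc n)" using j unfolding Q_def by (intro span_base) auto
    then show ?thesis using j A_W subspace_Q by (simp add: subspace_diff subspace_scale)
  qed
qed

lemma As_P:
  assumes "n \<le> d" "v \<in> P (Suc n)"
  shows "As v - \<theta>s n *s v \<in> P n"
proof (rule linear_maps_span_into[OF linear_As subspace_P _ assms(2)[unfolded P_def]])
  fix w assume "w \<in> (\<Union>j<Suc n. Ws j)"
  then obtain j where j: "j \<le> n" "w \<in> Ws j" by (auto simp: less_Suc_eq_le)
  show "As w - \<theta>s n *s w \<in> P n"
  proof (cases "j = n")
    case True
    then show ?thesis using j assms(1) As_Ws subspace_P by (simp add: subspace_0)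
  next
    case False
    then have "w \<in> P n" using j unfolding P_def by (intro span_base) auto
    then show ?thesis
      using As_Ws[of j w] j assms(1) subspace_P by (simp add: subspace_diff subspace_scale)
  qed
qed

text \<open>Tridiagonality lets \<open>As\<close> lower the index by at most one.\<close>

lemma As_Q:
  assumes "v \<in> Q (Suc n)"
  shows "As v \<in> Q n"
proof -
  have "As v - 0 *s v \<in> Q n"
  proof (rule linear_maps_span_into[OF linear_As subspace_Q _ assms[unfolded Q_def]])
    fix w assume "w \<in> (\<Union>j\<in>{Suc n..d}. W j)"
    then obtain j where j: "Suc n \<le> j" "j \<le> d" "w \<in> W j" by auto
    then have "As w \<in> span (\<Union>i\<in>{i. i \<le> d \<and> j \<le> i + 1 \<and> i \<le> j + 1}. W i)" using As_W by blast
    also have "\<dots> \<subseteq> Q n" unfolding Q_def using j by (intro span_UN_mono) auto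
    finally show "As w - 0 *s w \<in> Q n" by simp
  qed
  then show ?thesis by simp
qed

lemma A_P:
  assumes "n \<le> d" "v \<in> P n"
  shows "A v \<in> P (Suc n)"
proof -
  have "A v - 0 *s v \<in> P (Suc n)"
  proof (rule linear_maps_span_into[OF linear_A subspace_P _ assms(2)[unfolded P_def]])
    fix w assume "w \<in> (\<Union>j<n. Ws j)"
    then obtain j where j: "j < n" "w \<in> Ws j" by auto
    then have "A w \<in> span (\<Union>i\<in>{i. i \<le> d \<and> j \<le> i + 1 \<and> i \<le> j + 1}. Ws i)"
      using A_Ws assms(1) by (meson image_subset_iff le_trans less_imp_le)
    also have "\<dots> \<subseteq> P (Suc n)" unfolding P_def using j by (intro span_UN_mono) auto
    finally show "A w - 0 *s w \<in> P (Suc n)" by simp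
  qed
  then show ?thesis by simp
qed

section \<open>The invariant subspaces \<open>Z r\<close>\<close>

lemma Z_base: "\<lbrakk>i \<le> d; v \<in> P (Suc i); v \<in> Q (i + r)\<rbrakk> \<Longrightarrow> v \<in> Z r"
  unfolding Z_def by (intro span_base) blast

text \<open>\<open>A - \<theta> (i + r)\<close> sends the summand with index \<open>i\<close> into
  the one with index \<open>i + 1\<close>: the \<open>P\<close> index grows by tridiagonality, the
  \<open>Q\<close> index by \<open>A_Q\<close>. At \<open>i = d\<close> the image is zero because
  \<open>Q\<close> vanishes above \<open>d\<close>.\<close>

lemma A_Z: "A ` Z r \<subseteq> Z r"
proof
  fix u assume "u \<in> A ` Z r"
  then obtain v where v: "v \<in> Z r" "u = A v" by blast
  have "A v - 0 *s v \<in> Z r"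
  proof (rule linear_maps_span_into[OF linear_A subspace_Z _ v(1)[unfolded Z_def]])
    fix w assume "w \<in> (\<Union>i\<le>d. P (Suc i) \<inter> Q (i + r))"
    then obtain i where i: "i \<le> d" "w \<in> P (Suc i)" "w \<in> Q (i + r)" by auto
    let ?x = "A w - \<theta> (i + r) *s w"
    have Qx: "?x \<in> Q (Suc i + r)" using A_Q[OF i(3)] by simp
    have "?x \<in> Z r"
    proof (cases "i < d")
      case True
      have "?x \<in> P (Suc (Suc i))"
        using A_P[of "Suc i" w] P_mono[of "Suc i" "Suc (Suc i)"] i True
        by (intro subspace_diff subspace_scale) auto
      then show ?thesis using Z_base[of "Suc i"] Qx True by auto
    next
      case False
      then have "?x = 0" using Qx Q_above[of "Suc i + r"] by auto
      then show ?thesis by (simp add: subspace_0)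
    qed
    moreover have "w \<in> Z r" using Z_base i by blast
    ultimately have "?x + \<theta> (i + r) *s w \<in> Z r" by (intro subspace_add subspace_scale) auto
    then show "A w - 0 *s w \<in> Z r" by simp
  qed
  then show "u \<in> Z r" using v by simp
qed

text \<open>Dually, \<open>As - \<theta>s i\<close> lowers the summand index by one, and gives zero
  at \<open>i = 0\<close> since \<open>P 0\<close> is zero.\<close>

lemma As_Z: "As ` Z r \<subseteq> Z r"
proof
  fix u assume "u \<in> As ` Z r"
  then obtain v where v: "v \<in> Z r" "u = As v" by blast
  have "As v - 0 *s v \<in> Z r"
  proof (rule linear_maps_span_into[OF linear_As subspace_Z _ v(1)[unfolded Z_def]])
    fix w assume "w \<in> (\<Union>i\<le>d. P (Suc i) \<inter> Q (i + r))"
    then obtain i where i: "i \<le> d" "w \<in> P (Suc i)" "w \<in> Q (i + r)" by auto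
    let ?x = "As w - \<theta>s i *s w"
    have Px: "?x \<in> P i" using As_P[OF i(1,2)] by simp
    have "?x \<in> Z r"
    proof (cases i)
      case 0
      then have "?x = 0" using Px P_0 by auto
      then show ?thesis by (simp add: subspace_0)
    next
      case (Suc k)
      have "?x \<in> Q (k + r)"
        using As_Q[of w "k + r"] Q_antimono[of "k + r" "i + r"] i Suc
        by (intro subspace_diff subspace_scale) auto
      then show ?thesis using Z_base[of k] Px Suc i by auto
    qed
    moreover have "w \<in> Z r" using Z_base i by blast
    ultimately have "?x + \<theta>s i *s w \<in> Z r" by (intro subspace_add subspace_scale) auto
    then show "As w - 0 *s w \<in> Z r" by simp
  qed
  then show "u \<in> Z r" using v by simp
qed

text \<open>The summand with index 0 contains the nonzero space \<open>Ws 0\<close>, so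
  irreducibility leaves only the whole space.\<close>

lemma Z_0: "Z 0 = UNIV"
proof -
  obtain v where v: "v \<in> Ws 0" "v \<noteq> 0" using Ws_0 by blast
  then have "v \<in> P (Suc 0)" unfolding P_def by (intro span_base) auto
  then have "v \<in> Z 0" using Z_base[of 0 v 0] Q_0 by auto
  with v irreducible[of "Z 0"] A_Z As_Z show ?thesis by auto
qed

text \<open>Summands with \<open>i < d\<close> lie in \<open>P d\<close>, and the one with
  \<open>i = d\<close> lies in \<open>Q (d + 1)\<close>, which is zero. So \<open>Z 1\<close> is
  inside the proper subspace \<open>P d\<close>, and irreducibility makes it zero.\<close>

lemma Z_1: "Z 1 = {0}"
proof -
  have "P (Suc i) \<inter> Q (i + 1) \<subseteq> P d" if "i \<le> d" for i
    using that P_mono[of "Suc i" d] Q_above[of "i + 1"] subspace_0[OF subspace_P]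
    by (cases "i < d") auto
  then have "Z 1 \<subseteq> P d" unfolding Z_def by (intro span_minimal) auto
  then have "Z 1 \<noteq> UNIV" using span_Ws by (auto simp: P_def)
  then show ?thesis using irreducible[of "Z 1"] A_Z As_Z by auto
qed

text \<open>Split \<open>v\<close> using \<open>Z 0\<close>. The part \<open>y\<close> with indices
  above \<open>i\<close> is in \<open>Q (Suc i)\<close>, and in \<open>P (Suc i)\<close> as a
  difference; such vectors lie in \<open>Z 1\<close>, so \<open>y = 0\<close>.\<close>

lemma P_subset_split:
  assumes "i \<le> d"
  shows "P (Suc i) \<subseteq> span (\<Union>j\<le>i. P (Suc j) \<inter> Q j)"
proof
  fix v assume v: "v \<in> P (Suc i)"
  let ?U = "\<lambda>j. P (Suc j) \<inter> Q j"
  have "{..d} = {..i} \<union> {Suc i..d}" using assms by auto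
  then have "(\<Union>j\<le>d. ?U j) = (\<Union>j\<le>i. ?U j) \<union> (\<Union>j\<in>{Suc i..d}. ?U j)" by (simp add: UN_Un)
  then have "v \<in> span ((\<Union>j\<le>i. ?U j) \<union> (\<Union>j\<in>{Suc i..d}. ?U j))"
    using Z_0 unfolding Z_def by simp
  then obtain x y where xy: "v = x + y" "x \<in> span (\<Union>j\<le>i. ?U j)" "y \<in> span (\<Union>j\<in>{Suc i..d}. ?U j)"
    unfolding span_Un by auto
  have "(\<Union>j\<le>i. ?U j) \<subseteq> P (Suc i)" using P_mono[of "Suc _" "Suc i"] by fastforce
  then have "x \<in> P (Suc i)" using xy(2) span_minimal[OF _ subspace_P] by blast
  then have "y \<in> P (Suc i)" using subspace_diff[OF subspace_P v, of x] xy(1) by simp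
  moreover have "(\<Union>j\<in>{Suc i..d}. ?U j) \<subseteq> Q (Suc i)" using Q_antimono[of "Suc i"] by fastforce
  then have "y \<in> Q (Suc i)" using xy(3) span_minimal[OF _ subspace_Q] by blast
  ultimately have "y = 0" using Z_base[of i y 1] assms Z_1 by auto
  with xy show "v \<in> span (\<Union>j\<le>i. ?U j)" by simp
qed

text \<open>On the summands spanning \<open>P (Suc i)\<close>, \<open>f - \<mu> i\<close> is zero
  for \<open>j = i\<close> and a scalar for \<open>j < i\<close>, where the summand is already
  inside \<open>P i\<close>.\<close>

lemma split_scalar_map_triangular:
  assumes f: "Vector_Spaces.linear scale scale f"
    and U: "\<And>i v. \<lbrakk>i \<le> d; v \<in> P (Suc i) \<inter> Q i\<rbrakk> \<Longrightarrow> f v = \<mu> i *s v"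
    and i: "i \<le> d" and v: "v \<in> P (Suc i)"
  shows "f v - \<mu> i *s v \<in> P i"
proof (rule linear_maps_span_into[OF f subspace_P])
  show "v \<in> span (\<Union>j\<le>i. P (Suc j) \<inter> Q j)" using P_subset_split i v by blast
  fix w assume "w \<in> (\<Union>j\<le>i. P (Suc j) \<inter> Q j)"
  then obtain j where j: "j \<le> i" "w \<in> P (Suc j) \<inter> Q j" by auto
  show "f w - \<mu> i *s w \<in> P i"
  proof (cases "j = i")
    case True
    then show ?thesis using U[of j w] i j by (simp add: subspace_0)
  next
    case False
    then have "w \<in> P i" using P_mono[of "Suc j" i] j by auto
    then show ?thesis using U[of j w] i j by (simp add: subspace_diff subspace_scale)
  qed
qed

end

section \<open>Reversed orderings and the map \<open>M_map\<close>\<close>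

context tridiagonal
begin

lemma standard_ordering_span:
  assumes "diagonalizable f" "standard_ordering f g d W"
  shows "span (\<Union>j\<le>d. W j) = UNIV"
  using assms by (simp add: diagonalizable_def standard_ordering_def bij_betw_def)

text \<open>The neighbour relation between indices is symmetric under
  \<open>j \<mapsto> d - j\<close>. This turns the second split decomposition into an instance of
  the first.\<close>

lemma standard_ordering_reverse:
  assumes "standard_ordering f g d W"
  shows "standard_ordering f g d (\<lambda>i. W (d - i))"
proof -
  have "bij_betw (\<lambda>i. d - i) {..d} {..d}"
    by (rule bij_betw_byWitness[where f' = "\<lambda>i. d - i"]) auto
  with assms have "bij_betw (W \<circ> (\<lambda>i. d - i)) {..d} (eigenspaces f)"
    unfolding standard_ordering_def by (blast intro: bij_betw_trans)
  moreover have "g ` W (d - i) \<subseteq> span (\<Union>j\<in>{j. j \<le> d \<and> i \<le> j + 1 \<and> j \<le> i + 1}. W (d - j))"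
    if i: "i \<le> d" for i
  proof -
    have "{j. j \<le> d \<and> d - i \<le> j + 1 \<and> j \<le> d - i + 1}
        = (\<lambda>j. d - j) ` {j. j \<le> d \<and> i \<le> j + 1 \<and> j \<le> i + 1}" (is "?L = ?r ` ?R")
    proof (intro equalityI subsetI)
      fix j assume "j \<in> ?L"
      then show "j \<in> ?r ` ?R" using i by (intro image_eqI[of _ _ "d - j"]) auto
    qed (use i in auto)
    moreover have "g ` W (d - i) \<subseteq> span (\<Union>j\<in>?L. W j)"
      using assms unfolding standard_ordering_def by (meson diff_le_self)
    ultimately show ?thesis by simp
  qed
  ultimately show ?thesis by (simp add: standard_ordering_def comp_def)
qed

lemma linear_M_map:
  assumes "Vector_Spaces.linear scale scale K" "Vector_Spaces.linear scale scale B"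
  shows "Vector_Spaces.linear scale scale (M_map a K B)"
proof -
  interpret K: Vector_Spaces.linear scale scale K by fact
  interpret B: Vector_Spaces.linear scale scale B by fact
  show ?thesis
    by (rule Vector_Spaces.linear_iff[THEN iffD2])
      (auto simp: M_map_def K.add B.add K.scale B.scale algebra_simps intro: vector_space_axioms)
qed

lemma M_map_minus_scale:
  assumes "a \<noteq> inverse a"
  shows "M_map a K B v - c *s v
    = inverse (a - inverse a) *s (a *s (K v - c *s v) - inverse a *s (B v - c *s v))"
proof -
  have "inverse (a - inverse a) *s (a *s (K v - c *s v) - inverse a *s (B v - c *s v))
      = M_map a K B v - inverse (a - inverse a) *s ((a - inverse a) *s c *s v)"
    by (simp add: M_map_def scale_right_diff_distrib scale_left_diff_distrib mult.commute
        del: scale_scale)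
  then show ?thesis using assms by simp
qed

lemma M_map_diagonalizable:
  assumes d: "d \<ge> 1" and td: "td_system d A E As Es" and qr: "q_racah_type d A E As Es q a b"
    and K: "split_scalar_map d q (split_U d E Es) K"
    and B: "split_scalar_map d q (split_U_down d E Es) B"
  shows "diagonalizable (M_map a K B) \<and>
    {c. eigenvalue (M_map a K B) c} = {q powi (int d - 2 * int i) | i. i \<le> d}"
proof -
  define \<theta> where "\<theta> = (\<lambda>i. a * q powi (int d - 2 * int i) + inverse a * q powi (2 * int i - int d))"
  define \<theta>s where "\<theta>s = (\<lambda>i. b * q powi (int d - 2 * int i) + inverse b * q powi (2 * int i - int d))"
  define \<mu> where "\<mu> i = q powi (int d - 2 * int i)" for i :: nat
  define W where "W i = range (E i)" for i
  define Ws where "Ws i = range (Es i)" for i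
  have ord: "standard_ordering A As d W" and ords: "standard_ordering As A d Ws"
    and diag: "diagonalizable A" "diagonalizable As"
    and idem: "\<And>i. i \<le> d \<Longrightarrow> primitive_idempotent As (Ws i) (Es i)"
    using td by (simp_all add: td_system_def td_pair_def W_def[abs_def] Ws_def[abs_def])
  have irr: "\<And>S. \<lbrakk>subspace S; A ` S \<subseteq> S; As ` S \<subseteq> S\<rbrakk> \<Longrightarrow> S = {0} \<or> S = UNIV"
    using td unfolding td_system_def td_pair_def by blast
  have ev: "W i = eigenspace A (\<theta> i)" and evs: "Ws i = eigenspace As (\<theta>s i)"
      and nz: "eigenvalue As (\<theta>s i)" if "i \<le> d" for i
    using qr that
    by (auto simp: q_racah_type_def eigenvalue_sequence_def \<theta>_def \<theta>s_def W_def Ws_def)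
  \<comment> \<open>\<open>\<theta> i\<close> determines the eigenspace \<open>W i\<close>, and the
    ordering lists eigenspaces without repetition.\<close>
  have \<theta>_inj: "i = j" if "i \<le> d" "j \<le> d" "\<theta> i = \<theta> j" for i j
  proof -
    have "inj_on W {..d}" using ord by (simp add: standard_ordering_def bij_betw_def)
    then show ?thesis using ev[of i] ev[of j] that by (auto dest: inj_onD)
  qed
  have \<theta>_\<mu>: "\<theta> i = a * \<mu> i + inverse a * inverse (\<mu> i)" for i
    by (simp add: \<theta>_def \<mu>_def flip: power_int_minus)
  \<comment> \<open>By the preceding formula \<open>\<theta> i\<close> is a function of
    \<open>\<mu> i\<close>, so distinctness passes from \<open>\<theta>\<close> to
    \<open>\<mu>\<close>.\<close>
  have inj: "inj_on \<mu> {..<Suc d}"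
    by (rule inj_onI) (auto intro!: \<theta>_inj simp: \<theta>_\<mu>)
  \<comment> \<open>Otherwise \<open>\<theta>\<close> would be symmetric under
    \<open>i \<mapsto> d - i\<close>, so \<open>\<theta> 0 = \<theta> d\<close> although
    \<open>d \<ge> 1\<close>.\<close>
  have a: "a \<noteq> inverse a"
  proof
    assume *: "a = inverse a"
    have "\<mu> d = inverse (\<mu> 0)" by (simp add: \<mu>_def power_int_minus)
    then have "\<theta> 0 = \<theta> d" using * by (simp add: \<theta>_\<mu> add.commute)
    with \<theta>_inj[of 0 d] d show False by simp
  qed
  define F where "F n = span (\<Union>j<n. Ws j)" for n
  \<comment> \<open>The idempotent \<open>Es i\<close> separates the two spaces: it vanishes on
    \<open>F i\<close> but fixes a nonzero vector of \<open>Ws i\<close>.\<close>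
  have F_strict: "F i \<subset> F (Suc i)" if i: "i < Suc d" for i
  proof -
    have "Es i v = 0" if "v \<in> Ws j" "j < i" for j v
    proof -
      have "inj_on Ws {..d}" "Ws ` {..d} = eigenspaces As"
        using ords by (simp_all add: standard_ordering_def bij_betw_def)
      then have "Ws j \<noteq> Ws i" "Ws j \<in> eigenspaces As"
        using \<open>j < i\<close> i inj_onD[of Ws "{..d}" j i] by auto
      then show ?thesis using idem[of i] i that by (auto simp: primitive_idempotent_def)
    qed
    moreover have lin: "Vector_Spaces.linear scale scale (Es i)"
      using idem[of i] i by (simp add: primitive_idempotent_def)
    ultimately have ker: "Es i v = 0" if "v \<in> F i" for v
      using linear_maps_span_into[OF lin subspace_single_0, of "\<Union>j<i. Ws j" 0 v] that
      by (auto simp: F_def)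
    obtain v where v: "v \<noteq> 0" "v \<in> Ws i"
      using nz[of i] evs[of i] i by (auto simp: eigenvalue_def eigenspace_def)
    then have "Es i v = v" using idem[of i] i by (simp add: primitive_idempotent_def)
    then have "v \<notin> F i" using ker v by auto
    moreover have "v \<in> F (Suc i)" unfolding F_def using v by (intro span_base) auto
    moreover have "F i \<subseteq> F (Suc i)" unfolding F_def by (intro span_UN_mono) auto
    ultimately show ?thesis by blast
  qed
  \<comment> \<open>Stated for any standard ordering \<open>X\<close>, to be instantiated with both
    \<open>W\<close> and its reversal.\<close>
  have flags: "split_flags scale d A As \<phi> \<theta>s X Ws"
    if X: "standard_ordering A As d X" "\<And>i. i \<le> d \<Longrightarrow> X i = eigenspace A (\<phi> i)" for X \<phi>
  proof (intro split_flags.intro split_flags_axioms.intro tridiagonal_axioms)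
    show "Vector_Spaces.linear scale scale A" "Vector_Spaces.linear scale scale As"
      using diag by (simp_all add: diagonalizable_def)
    show "span (\<Union>j\<le>d. X j) = UNIV" using standard_ordering_span diag X by blast
    show "\<not> Ws 0 \<subseteq> {0}" using evs[of 0] nz[of 0] by (auto simp: eigenvalue_def eigenspace_def)
    show "span (\<Union>j<d. Ws j) \<noteq> UNIV" using F_strict[of d] by (auto simp: F_def)
  qed (use X ords evs irr in \<open>auto simp: standard_ordering_def eigenspace_def\<close>)
  interpret U: split_flags scale d A As \<theta> \<theta>s W Ws
    by (rule flags[OF ord ev])
  interpret D: split_flags scale d A As "\<lambda>i. \<theta> (d - i)" \<theta>s "\<lambda>i. W (d - i)" Ws
    by (rule flags[OF standard_ordering_reverse[OF ord]]) (simp add: ev)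
  have P: "U.P = F" "D.P = F" by (simp_all add: U.P_def D.P_def F_def fun_eq_iff)
  have F_atMost: "span (\<Union>j\<in>{0..i}. Ws j) = F (Suc i)" for i
    by (simp add: F_def lessThan_Suc_atMost atMost_atLeast0)
  have U_eq: "split_U d E Es i = F (Suc i) \<inter> U.Q i" for i
    using F_atMost[of i] by (simp add: split_U_def U.Q_def W_def Ws_def)
  \<comment> \<open>For \<open>i > d\<close> truncated subtraction would leave
    \<open>{0..d - i}\<close> nonempty while \<open>{i..d}\<close> is empty, hence the
    bound.\<close>
  have D_eq: "split_U_down d E Es i = F (Suc i) \<inter> D.Q i" if i: "i \<le> d" for i
  proof -
    have "{0..d - i} = (\<lambda>j. d - j) ` {i..d}"
    proof (intro equalityI subsetI)
      fix j assume "j \<in> {0..d - i}"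
      then show "j \<in> (\<lambda>j. d - j) ` {i..d}" using i by (intro image_eqI[of _ _ "d - j"]) auto
    qed auto
    then show ?thesis
      using F_atMost[of i] unfolding split_U_down_def D.Q_def by (simp add: W_def Ws_def)
  qed
  have linK: "Vector_Spaces.linear scale scale K" and linB: "Vector_Spaces.linear scale scale B"
    using K B by (simp_all add: split_scalar_map_def)
  have triK: "K v - \<mu> i *s v \<in> F i" and triB: "B v - \<mu> i *s v \<in> F i"
    if "i < Suc d" "v \<in> F (Suc i)" for i v
  proof -
    show "K v - \<mu> i *s v \<in> F i"
      using U.split_scalar_map_triangular[OF linK, of \<mu> i v] K U_eq that
      by (simp add: P split_scalar_map_def \<mu>_def)
    show "B v - \<mu> i *s v \<in> F i"
      using D.split_scalar_map_triangular[OF linB, of \<mu> i v] B D_eq that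
      by (simp add: P split_scalar_map_def \<mu>_def)
  qed
  have triM: "M_map a K B v - \<mu> i *s v \<in> F i" if "i < Suc d" "v \<in> F (Suc i)" for i v
    unfolding M_map_minus_scale[OF a] using triK[OF that] triB[OF that]
    unfolding F_def by (rule span_scale[OF span_diff[OF span_scale span_scale]])
  have FU: "F (Suc d) = UNIV"
    using standard_ordering_span[OF diag(2) ords] by (simp add: F_def lessThan_Suc_atMost)
  have F0: "F 0 = {0}" and sub: "\<And>i. subspace (F i)" by (simp_all add: F_def)
  note res = triangular_flag_diagonalizable[where F = F and n = "Suc d" and \<mu> = \<mu>,
      OF linear_M_map[OF linK linB] sub F0 FU F_strict triM inj]
  have "\<mu> ` {..<Suc d} = {q powi (int d - 2 * int i) | i. i \<le> d}"
    by (auto simp: \<mu>_def)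
  with res show ?thesis by simp
qed

end

theorem lemma8p1:
  fixes scale :: "'k::alg_closed_field \<Rightarrow> 'v::ab_group_add \<Rightarrow> 'v"
    and Basis :: "'v set"
    and d :: nat
    and A As K B :: "'v \<Rightarrow> 'v"
    and E Es :: "nat \<Rightarrow> 'v \<Rightarrow> 'v"
    and q a b :: 'k
  assumes "finite_dimensional_vector_space scale Basis"
    and "vector_space.dim scale (UNIV :: 'v set) > 0"
    and "d \<ge> 1"
    and "tridiagonal.td_system scale d A E As Es"
    and "tridiagonal.q_racah_type scale d A E As Es q a b"
    and "tridiagonal.split_scalar_map scale d q (tridiagonal.split_U scale d E Es) K"
    and "tridiagonal.split_scalar_map scale d q (tridiagonal.split_U_down scale d E Es) B"
  shows "tridiagonal.diagonalizable scale (tridiagonal.M_map scale a K B) \<and>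
    {c. tridiagonal.eigenvalue scale (tridiagonal.M_map scale a K B) c} =
      {q powi (int d - 2 * int i) | i. i \<le> d}"
proof -
  interpret finite_dimensional_vector_space scale Basis by fact
  interpret tridiagonal scale by unfold_locales
  show ?thesis using assms(3-) by (rule M_map_diagonalizable)
qed

end
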